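(* Let $(X,d)$ be an ultrametric space and, for each $p\in X$, let $D_p(X):=\{d(p,x): x\in X\}$. If the inclusion $\mathbf{B}_X\subseteq\mathbf{Cs}_X$ holds, then the set $D_p(X)\cap[0,r)$ has a greatest element for all $p\in X$ and $r\in(0,\infty)$. Moreover, if $(X,d)\in\mathbf{UT}$ and the set $D_p(X)\cap[0,r)$ has a greatest element for all $p\in X$ and $r\in(0,\infty)$, then the inclusion $\mathbf{B}_X\subseteq\mathbf{Cs}_X$ holds.
   Context: $\mathbb{R}^+=[0,+\infty)$. All metric spaces are non-empty. A metric space $(X,d)$ is ultrametric if $d(x,y)\le\max\{d(x,z),d(z,y)\}$ for all $x,y,z\in X$. $\mathbf{B}_X$ is the set of all open balls $B_r(c)=\{x\in X: d(c,x)<r\}$ with $c\in X$ and $r>0$. A set $S\subseteq X$ is a centered sphere in $(X,d)$ if there exist $c\in S$ and $r\in\mathbb{R}^+$ such that $S=\{x\in X: d(x,c)=r\}\cup\{c\}$. $\mathbf{Cs}_X$ is the set of all centered spheres in $(X,d)$. A tree is a connected (simple, undirected, possibly infinite, non-empty) graph without cycles. A labeled tree $T=T(l)$ is a tree $T$ with a labeling $l\colon V(T)\to\mathbb{R}^+$. The labeling is non-degenerate if $\max\{l(u),l(v)\}>0$ for every edge $\{u,v\}\in E(T)$. For a non-degenerate labeling, the function $d_l$ on $V(T)\times V(T)$ given by $d_l(u,u)=0$ and $d_l(u,v)=\max_{w\in V(P_{u,v})} l(w)$ for $u\ne v$, where $P_{u,v}$ is the (unique, finite) path in $T$ joining $u$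 and $v$ (including its endpoints), is an ultrametric on $V(T)$. $\mathbf{UT}$ denotes the class of all ultrametric spaces isometric (via a bijective distance-preserving map) to $(V(T),d_l)$ for some labeled tree $T(l)$ with non-degenerate labeling. *)

theory Defs
  imports "HOL-Analysis.Analysis" "Graph_Theory.Graph_Theory"
begin

locale Ultrametric_space = Metric_space +
  assumes nonempty: "M \<noteq> {}"
    and ultrametric: "\<lbrakk>x \<in> M; y \<in> M; z \<in> M\<rbrakk> \<Longrightarrow> d x y \<le> max (d x z) (d z y)"

definition open_balls :: "'a set \<Rightarrow> ('a \<Rightarrow> 'a \<Rightarrow> real) \<Rightarrow> 'a set set" where
  "open_balls M d = {Metric_space.mball M d c r | c r. c \<in> M \<and> 0 < r}"

definition centered_spheres :: "'a set \<Rightarrow> ('a \<Rightarrow> 'a \<Rightarrow> real) \<Rightarrow> 'a set set" where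
  "centered_spheres M d =
     {S. S \<subseteq> M \<and> (\<exists>c\<in>S. \<exists>r\<ge>0. S = {x \<in> M. d x c = r} \<union> {c})}"

definition dist_set :: "'a set \<Rightarrow> ('a \<Rightarrow> 'a \<Rightarrow> real) \<Rightarrow> 'a \<Rightarrow> real set" where
  "dist_set M d p = {d p x | x. x \<in> M}"

definition has_greatest :: "real set \<Rightarrow> bool" where
  "has_greatest A \<longleftrightarrow> (\<exists>m\<in>A. \<forall>t\<in>A. t \<le> m)"

text \<open>
  A simple undirected graph, possibly infinite, is a symmetric loop-free set of
  pairs, i.e. a \<^locale>\<open>pair_bidirected_digraph\<close>. The constant \<open>tree\<close> of
  Digraph_Component is not usable here: in a symmetric digraph it counts each
  walk \<open>a, b, a\<close> as a cycle. Undirected cycles are given below by their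
  sequence of at least three pairwise distinct vertices. Connectedness includes
  that the vertex set is non-empty.
\<close>

definition undirected_cycle :: "'v pair_pre_digraph \<Rightarrow> 'v list \<Rightarrow> bool" where
  "undirected_cycle T p \<longleftrightarrow>
     vpath p (with_proj T) \<and> 3 \<le> length p \<and> (last p, hd p) \<in> parcs T"

definition undirected_tree :: "'v pair_pre_digraph \<Rightarrow> bool" where
  "undirected_tree T \<longleftrightarrow>
     pair_bidirected_digraph T \<and> Digraph_Component.connected (with_proj T) \<and>
     (\<nexists>p. undirected_cycle T p)"

definition labeled_tree :: "'v pair_pre_digraph \<Rightarrow> ('v \<Rightarrow> real) \<Rightarrow> bool" where
  "labeled_tree T l \<longleftrightarrow> undirected_tree T \<and> (\<forall>v\<in>pverts T. 0 \<le> l v)"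

definition nondegenerate :: "'v pair_pre_digraph \<Rightarrow> ('v \<Rightarrow> real) \<Rightarrow> bool" where
  "nondegenerate T l \<longleftrightarrow> (\<forall>(u, v)\<in>parcs T. 0 < max (l u) (l v))"

definition tree_path :: "'v pair_pre_digraph \<Rightarrow> 'v \<Rightarrow> 'v \<Rightarrow> 'v list" where
  "tree_path T u v = (THE p. vpath p (with_proj T) \<and> hd p = u \<and> last p = v)"

definition label_dist :: "'v pair_pre_digraph \<Rightarrow> ('v \<Rightarrow> real) \<Rightarrow> 'v \<Rightarrow> 'v \<Rightarrow> real" where
  "label_dist T l u v = (if u = v then 0 else Max (l ` set (tree_path T u v)))"

text \<open>
  HOL cannot quantify over the type of the vertices inside a formula, so the class
  of spaces generated by labeled trees takes this type as an argument. As a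
  hypothesis with a free type variable, it ranges over trees on every type.
\<close>

definition in_UT :: "'v itself \<Rightarrow> 'a set \<Rightarrow> ('a \<Rightarrow> 'a \<Rightarrow> real) \<Rightarrow> bool" where
  "in_UT (_ :: 'v itself) M d \<longleftrightarrow>
     (\<exists>(T :: 'v pair_pre_digraph) l f.
        labeled_tree T l \<and> nondegenerate T l \<and> bij_betw f M (pverts T) \<and>
        (\<forall>x\<in>M. \<forall>y\<in>M. label_dist T l (f x) (f y) = d x y))"

end

theory Submission
  imports Defs
begin

text \<open>
  In an ultrametric space every point of a ball is a centre of it. If a ball of radius \<open>r\<close> around
  \<open>p\<close> is a centered sphere of radius \<open>s\<close>, the greatest distance from \<open>p\<close> below \<open>r\<close> is therefore
  \<open>s\<close>, or \<open>0\<close> if the ball is a singleton. Conversely, let \<open>m > 0\<close> be the greatest distance from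
  \<open>c\<close> below \<open>r\<close> in the space of a labeled tree, attained at \<open>x\<close>. Some vertex \<open>a\<close> on the path
  from \<open>c\<close> to \<open>x\<close> has label \<open>m\<close>. It lies in the ball, and its distance to any other point is at
  least its label \<open>m\<close>, so the ball is the centered sphere of radius \<open>m\<close> around \<open>a\<close>.
\<close>

section \<open>Walks and paths in undirected trees\<close>

lemma vwalk_append_iff:
  "p \<noteq> [] \<Longrightarrow> q \<noteq> [] \<Longrightarrow>
     vwalk (p @ q) G \<longleftrightarrow> vwalk p G \<and> vwalk q G \<and> (last p, hd q) \<in> arcs_ends G"
  by (auto simp: vwalk_def vwalk_arcs_append)

lemma vwalk_rev:
  assumes "symmetric G" "vwalk p G"
  shows "vwalk (rev p) G"
  using assms by (auto simp: vwalk_def set_vwalk_arcs_rev symmetric_def sym_def)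

text \<open>Arcs come in both directions, so connectedness gives a directed walk from
  \<open>u\<close> to \<open>v\<close>, which can be shortened to a path.\<close>

lemma undirected_tree_vpath_exists:
  assumes "undirected_tree T" "u \<in> pverts T" "v \<in> pverts T"
  shows "\<exists>p. vpath p (with_proj T) \<and> hd p = u \<and> last p = v"
proof -
  interpret pair_bidirected_digraph T
    using assms by (simp add: undirected_tree_def)
  have "strongly_connected (with_proj T)"
    using symmetric_connected_imp_strongly_connected[OF sym_arcs] assms(1)
    by (simp add: undirected_tree_def)
  then have "u \<rightarrow>\<^sup>*\<^bsub>with_proj T\<^esub> v"
    using assms by auto
  then show ?thesis
    by (metis reachable_vwalk_conv vwalk_imp_ex_vpath)
qed

text \<open>Follow \<open>p\<close> from \<open>u\<close> to the first vertex \<open>w\<close> that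
  also lies on \<open>q\<close>, then return to \<open>u\<close> along \<open>q\<close>. By the
  choice of \<open>w\<close> no vertex repeats on the way.\<close>

lemma undirected_cycle_of_diverging_vpaths:
  assumes sym: "symmetric (with_proj T)"
    and p: "vpath (u # p) (with_proj T)" and q: "vpath (u # q) (with_proj T)"
    and ne: "p \<noteq> []" "q \<noteq> []" "hd p \<noteq> hd q" and last: "last p = last q"
  shows "\<exists>c. undirected_cycle T c"
proof -
  have "\<exists>x\<in>set p. x \<in> set q"
    using ne last by (metis last_in_set)
  then obtain p1 w p2 where p_eq: "p = p1 @ w # p2" and w: "w \<in> set q"
    and disj: "\<forall>x\<in>set p1. x \<notin> set q"
    by (rule split_list_first_propE) (rule that; auto)
  from w obtain q1 q2 where q_eq: "q = q1 @ w # q2"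
    by (auto dest: split_list)
  \<comment> \<open>Otherwise \<open>w\<close> would be the head of both paths. A vertex strictly
    between \<open>u\<close> and \<open>w\<close> gives the cycle its third vertex.\<close>
  have nontriv: "p1 \<noteq> [] \<or> q1 \<noteq> []"
    using ne(3) p_eq q_eq by auto
  have "vwalk ((u # p1 @ [w]) @ p2) (with_proj T)"
    using p p_eq by (auto simp: vpath_def)
  then have p1: "vwalk (u # p1 @ [w]) (with_proj T)"
    by (rule vwalkI_append_l[rotated]) simp
  have "vwalk ((u # q1 @ [w]) @ q2) (with_proj T)"
    using q q_eq by (auto simp: vpath_def)
  then have q1: "vwalk (u # q1 @ [w]) (with_proj T)"
    by (rule vwalkI_append_l[rotated]) simp
  let ?c = "(u # p1 @ [w]) @ rev q1"
  have "vwalk ?c (with_proj T) \<and> (last ?c, u) \<in> parcs T"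
  \<comment> \<open>If \<open>q1\<close> is empty, the arc from \<open>w\<close> to \<open>u\<close>
    closes the cycle; otherwise the closing arc leaves the head of \<open>q1\<close>.\<close>
  proof (cases q1 rule: list.exhaust)
    case Nil
    then show ?thesis
      using p1 vwalk_rev[OF sym q1] by (auto simp: vwalk_def)
  next
    case (Cons y ys)
    from vwalk_rev[OF sym q1]
    have "vwalk ([w] @ rev q1 @ [u]) (with_proj T)"
      by simp
    with Cons have "vwalk (rev q1) (with_proj T)"
      and "(w, hd (rev q1)) \<in> arcs_ends (with_proj T)"
      and "(last (rev q1), u) \<in> arcs_ends (with_proj T)"
      by (simp_all del: rev.simps append_Cons append_Nil add: vwalk_append_iff)
    moreover have "vwalk ?c (with_proj T) \<longleftrightarrow> vwalk (u # p1 @ [w]) (with_proj T) \<and>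
        vwalk (rev q1) (with_proj T) \<and> (w, hd (rev q1)) \<in> arcs_ends (with_proj T)"
      using Cons by (subst vwalk_append_iff) auto
    ultimately show ?thesis
      using p1 Cons by simp
  qed
  moreover have "distinct ?c"
    using p q p_eq q_eq disj by (auto simp: vpath_def)
  moreover have "3 \<le> length ?c"
    using nontriv by (cases p1; cases q1) auto
  ultimately have "undirected_cycle T ?c"
    by (auto simp: undirected_cycle_def vpath_def)
  then show ?thesis ..
qed

text \<open>Induction along the path: if the second vertices differed, the two paths would diverge
  and meet again, giving a cycle.\<close>

lemma undirected_tree_vpath_unique:
  assumes T: "undirected_tree T"
  shows "vpath p (with_proj T) \<Longrightarrow> vpath q (with_proj T) \<Longrightarrow> hd p = hd q \<Longrightarrow> last p = last q \<Longrightarrow> p = q"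
proof (induction p arbitrary: q)
  case Nil
  then show ?case by auto
next
  case (Cons u p)
  interpret pair_bidirected_digraph T
    using T by (simp add: undirected_tree_def)
  from Cons.prems obtain q' where q: "q = u # q'"
    by (cases q) auto
  \<comment> \<open>If just one of the tails were empty, its path would end at \<open>u\<close>, so
    \<open>u\<close> would occur again in the other tail, against distinctness.\<close>
  have trivial: "p = [] \<longleftrightarrow> q' = []"
    using Cons.prems unfolding q vpath_def
    by (metis distinct.simps(2) last.simps last_in_set)
  show ?case
  proof (cases "p = []")
    case True
    with trivial q show ?thesis by simp
  next
    case False
    with trivial have "q' \<noteq> []" by simp
    have last: "last p = last q'"
      using Cons.prems(4) False \<open>q' \<noteq> []\<close> q by simp
    have "vpath (u # q') (with_proj T)"
      using Cons.prems(2) q by simp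
    from undirected_cycle_of_diverging_vpaths[OF sym_arcs Cons.prems(1) this False \<open>q' \<noteq> []\<close> _ last]
    have "hd p = hd q'"
      using T unfolding undirected_tree_def by blast
    moreover have "vpath p (with_proj T)" "vpath q' (with_proj T)"
      using Cons.prems(1,2) q False \<open>q' \<noteq> []\<close> by (auto simp: vpath_def elim: vwalk_consE)
    ultimately have "p = q'"
      using Cons.IH last by blast
    with q show ?thesis by simp
  qed
qed

lemma tree_path_eqI:
  assumes "undirected_tree T" "vpath p (with_proj T)"
  shows "tree_path T (hd p) (last p) = p"
  unfolding tree_path_def
  using assms(2) undirected_tree_vpath_unique[OF assms(1)] by (intro the_equality) metis+

lemma tree_path_props:
  assumes "undirected_tree T" "u \<in> pverts T" "v \<in> pverts T"
  shows "vpath (tree_path T u v) (with_proj T)" "hd (tree_path T u v) = u"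
    "last (tree_path T u v) = v"
  using undirected_tree_vpath_exists[OF assms] tree_path_eqI[OF assms(1)] by metis+

section \<open>Vertex labels and the distance of a labeled tree\<close>

lemma label_le_label_dist:
  assumes "undirected_tree T" "u \<in> pverts T" "v \<in> pverts T" "u \<noteq> v"
  shows "l u \<le> label_dist T l u v"
proof -
  have "u \<in> set (tree_path T u v)"
    using tree_path_props[OF assms(1-3)] by (metis hd_in_set vpathE vwalkE)
  with \<open>u \<noteq> v\<close> show ?thesis
    by (simp add: label_dist_def)
qed

text \<open>Let \<open>a\<close> carry the maximal label on the path from \<open>u\<close> to
  \<open>v\<close>. The initial segment ending in \<open>a\<close> is the path from \<open>u\<close>
  to \<open>a\<close>, so its labels have no larger maximum. Such an \<open>a\<close> later serves
  as the centre of a sphere.\<close>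

lemma label_dist_attained:
  assumes T: "undirected_tree T" and uv: "u \<in> pverts T" "v \<in> pverts T" "u \<noteq> v"
    and nonneg: "\<forall>w\<in>pverts T. 0 \<le> l w"
  obtains a where "a \<in> pverts T" "l a = label_dist T l u v"
    "label_dist T l u a \<le> label_dist T l u v"
proof -
  define p where "p = tree_path T u v"
  have p: "vpath p (with_proj T)" "hd p = u" "last p = v"
    using tree_path_props[OF T uv(1,2)] by (simp_all add: p_def)
  from p(1) have "p \<noteq> []" and sub: "set p \<subseteq> pverts T"
    by (simp_all add: vpath_def vwalk_def)
  have dist: "label_dist T l u v = Max (l ` set p)"
    using uv(3) by (simp add: label_dist_def p_def)
  have "Max (l ` set p) \<in> l ` set p"
    using \<open>p \<noteq> []\<close> by (intro Max_in) auto
  then obtain a where a: "a \<in> set p" "l a = Max (l ` set p)"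
    by (metis imageE)
  from split_list[OF a(1)] obtain p1 p2 where split: "p = (p1 @ [a]) @ p2"
    by auto
  have "vpath (p1 @ [a]) (with_proj T)"
    using p(1) split vwalkI_append_l[of "p1 @ [a]" p2] by (auto simp: vpath_def)
  moreover have "hd (p1 @ [a]) = u"
    using p(2) split by (cases p1) auto
  ultimately have path: "tree_path T u a = p1 @ [a]"
    using tree_path_eqI[OF T] by (metis last_snoc)
  have "label_dist T l u a \<le> Max (l ` set p)"
  \<comment> \<open>On the diagonal the distance is 0 by definition and not a maximum of labels, so
    the bound comes from nonnegativity of the labels.\<close>
  proof (cases "u = a")
    case True
    then have "label_dist T l u a = 0"
      by (simp add: label_dist_def)
    also have "0 \<le> l a"
      using a(1) sub nonneg by blast
    finally show ?thesis
      using a(2) by simp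
  next
    case False
    then have "label_dist T l u a = Max (l ` set (p1 @ [a]))"
      by (simp add: label_dist_def path)
    also have "\<dots> \<le> Max (l ` set p)"
      using split by (intro Max_mono) auto
    finally show ?thesis .
  qed
  moreover have "a \<in> pverts T"
    using a(1) sub by blast
  ultimately show thesis
    using that a(2) dist by metis
qed

section \<open>Open balls and centered spheres\<close>

context Ultrametric_space
begin

lemma has_greatest_of_ball_eq_sphere:
  assumes "p \<in> M" "0 < r" and S: "mball p r \<in> centered_spheres M d"
  shows "has_greatest (dist_set M d p \<inter> {0..<r})"
proof -
  from S obtain c s where c: "c \<in> mball p r" and "0 \<le> s"
    and eq: "mball p r = {x \<in> M. d x c = s} \<union> {c}"
    unfolding centered_spheres_def by blast
  have "p \<in> mball p r"
    using assms by simp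
  have sphere: "d z c = s" if "z \<in> mball p r" "z \<noteq> c" for z
  proof -
    have "z \<in> {x \<in> M. d x c = s} \<union> {c}"
      using that(1) unfolding eq .
    with that(2) show ?thesis by simp
  qed
  show ?thesis
  proof (cases "\<exists>x\<in>mball p r. x \<noteq> p")
    case False
    then have "0 \<in> dist_set M d p \<inter> {0..<r}"
      and "\<forall>t\<in>dist_set M d p \<inter> {0..<r}. t \<le> 0"
      using assms by (force simp: dist_set_def)+
    then show ?thesis
      unfolding has_greatest_def by blast
  next
    case True
    then obtain x where x: "x \<in> mball p r" "x \<noteq> p" by blast
    \<comment> \<open>All points of the ball, \<open>p\<close> included, lie within \<open>s\<close>
      of \<open>c\<close>, and the ultrametric inequality through \<open>c\<close> carries this
      bound over to \<open>p\<close>.\<close>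
    have bound: "d p y \<le> s" if "y \<in> mball p r" for y
    proof -
      have "d z c \<le> s" if "z \<in> mball p r" for z
        using sphere[OF that] c \<open>0 \<le> s\<close> by (cases "z = c") auto
      then have "d p c \<le> s" "d y c \<le> s"
        using that \<open>p \<in> mball p r\<close> by auto
      moreover have "d p y \<le> max (d p c) (d c y)"
        using that c assms by (intro ultrametric) auto
      ultimately show ?thesis
        by (simp add: commute)
    qed
    \<comment> \<open>The witness is \<open>c\<close> itself, unless \<open>p\<close> is the centre;
      then it is the second point \<open>x\<close>.\<close>
    have "\<exists>y\<in>mball p r. d p y = s"
    proof (cases "p = c")
      case True
      with x sphere[OF x(1)] show ?thesis
        by (metis commute)
    next
      case False
      with c sphere[OF \<open>p \<in> mball p r\<close>] show ?thesis
        by blast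
    qed
    then have "s \<in> dist_set M d p \<inter> {0..<r}"
      using \<open>0 \<le> s\<close> by (auto simp: dist_set_def)
    moreover have "\<forall>t\<in>dist_set M d p \<inter> {0..<r}. t \<le> s"
      using bound assms by (auto simp: dist_set_def)
    ultimately show ?thesis
      unfolding has_greatest_def by blast
  qed
qed

lemma ball_eq_sphere_of_has_greatest:
  assumes UT: "in_UT TYPE('v) M d" and "c \<in> M" "0 < r"
    and max: "has_greatest (dist_set M d c \<inter> {0..<r})"
  shows "mball c r \<in> centered_spheres M d"
proof -
  from UT obtain T :: "'v pair_pre_digraph" and l f where
    T: "undirected_tree T" and label_nonneg: "\<forall>v\<in>pverts T. 0 \<le> l v" and
    bij: "bij_betw f M (pverts T)" and
    iso: "\<And>x y. x \<in> M \<Longrightarrow> y \<in> M \<Longrightarrow> label_dist T l (f x) (f y) = d x y"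
    unfolding in_UT_def labeled_tree_def by blast
  have f_in: "f x \<in> pverts T" if "x \<in> M" for x
    using bij that unfolding bij_betw_def by blast
  have f_neq: "f x \<noteq> f y" if "x \<in> M" "y \<in> M" "x \<noteq> y" for x y
    using bij that unfolding bij_betw_def inj_on_def by blast
  from max obtain x where x: "x \<in> M" "d c x < r"
    and greatest: "\<And>y. y \<in> M \<Longrightarrow> d c y < r \<Longrightarrow> d c y \<le> d c x"
    unfolding has_greatest_def dist_set_def by fastforce
  show ?thesis
  proof (cases "x = c")
    case True
    \<comment> \<open>The greatest distance is 0 here, so the ball is \<open>{c}\<close>, a sphere
      of radius 0.\<close>
    have "y = c" if "y \<in> M" "d c y < r" for y
      using greatest[OF that] that(1) \<open>c \<in> M\<close> True zero[of c y] nonneg[of c y] by simp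
    then have "mball c r = {x \<in> M. d x c = 0} \<union> {c}"
      using \<open>c \<in> M\<close> \<open>0 < r\<close> by auto
    then show ?thesis
      using assms unfolding centered_spheres_def by auto
  next
    case False
    define m where "m = d c x"
    have "f c \<noteq> f x"
      using f_neq x \<open>c \<in> M\<close> False by blast
    from label_dist_attained[OF T f_in[OF \<open>c \<in> M\<close>] f_in[OF x(1)] this label_nonneg]
    obtain v where v: "v \<in> pverts T" "l v = m" "label_dist T l (f c) v \<le> m"
      unfolding iso[OF \<open>c \<in> M\<close> x(1)] m_def .
    from v(1) bij obtain a where a: "a \<in> M" "v = f a"
      unfolding bij_betw_def by blast
    have ca: "d c a \<le> m"
      using v(3) iso[OF \<open>c \<in> M\<close> a(1)] a(2) by simp
    have "m < r" "0 \<le> m"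
      using x by (auto simp: m_def)
    \<comment> \<open>The upper bound passes through \<open>c\<close>; the lower one holds because
      \<open>f a\<close>, with label \<open>m\<close>, is an endpoint of the path to
      \<open>f y\<close>.\<close>
    have "d y a = m" if y: "y \<in> M" "d c y < r" "y \<noteq> a" for y
    proof (rule antisym)
      have "d y a \<le> max (d y c) (d c a)"
        using y a \<open>c \<in> M\<close> by (intro ultrametric)
      then show "d y a \<le> m"
        using greatest[OF y(1,2)] ca by (simp add: m_def commute)
      have "l (f a) \<le> label_dist T l (f a) (f y)"
        using label_le_label_dist[OF T f_in[OF a(1)] f_in[OF y(1)] f_neq[OF a(1) y(1)]] y(3)
        by blast
      then show "m \<le> d y a"
        using iso[OF a(1) y(1)] v(2) a(2) by (simp add: commute)
    qed
    \<comment> \<open>Conversely, the sphere stays in the ball: \<open>c\<close> and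
      \<open>y\<close> are both within \<open>m\<close> of \<open>a\<close>, and \<open>m\<close> is
      below \<open>r\<close>.\<close>
    moreover have "d c y < r" if y: "y \<in> M" "d y a = m" for y
    proof -
      have "d c y \<le> max (d c a) (d a y)"
        using y a \<open>c \<in> M\<close> by (intro ultrametric)
      with ca y(2) \<open>m < r\<close> show ?thesis
        by (simp add: commute)
    qed
    moreover have "d c a < r"
      using ca \<open>m < r\<close> by simp
    ultimately have "mball c r = {y \<in> M. d y a = m} \<union> {a}"
      unfolding mball_def using \<open>c \<in> M\<close> a(1) by blast
    then show ?thesis
      using a(1) \<open>0 \<le> m\<close> unfolding centered_spheres_def by auto
  qed
qed

end

theorem theorem6:
  fixes X :: "'a set" and d :: "'a \<Rightarrow> 'a \<Rightarrow> real"
  assumes "Ultrametric_space X d"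
  shows "(open_balls X d \<subseteq> centered_spheres X d \<longrightarrow>
            (\<forall>p\<in>X. \<forall>r>0. has_greatest (dist_set X d p \<inter> {0..<r})))
       \<and> (in_UT TYPE('v) X d \<and> (\<forall>p\<in>X. \<forall>r>0. has_greatest (dist_set X d p \<inter> {0..<r})) \<longrightarrow>
            open_balls X d \<subseteq> centered_spheres X d)"
proof -
  interpret Ultrametric_space X d by fact
  show ?thesis
  proof (intro conjI impI ballI allI subsetI)
    fix p :: 'a and r :: real
    assume "open_balls X d \<subseteq> centered_spheres X d" "p \<in> X" "0 < r"
    then show "has_greatest (dist_set X d p \<inter> {0..<r})"
      by (intro has_greatest_of_ball_eq_sphere) (auto simp: open_balls_def)
  next
    fix B
    assume "in_UT TYPE('v) X d \<and> (\<forall>p\<in>X. \<forall>r>0. has_greatest (dist_set X d p \<inter> {0..<r}))"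
      and "B \<in> open_balls X d"
    then show "B \<in> centered_spheres X d"
      by (auto simp: open_balls_def intro: ball_eq_sphere_of_has_greatest)
  qed
qed

end
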